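(* Suppose that: $K$ and $K''$ are functions of bounded variation on $\mathbb{R}$; for each $G\in\{K,K''\}$, $\int_{\mathbb{R}}|uG(u)|\,du<+\infty$ and $\int_{\mathbb{R}}u^2G(u)\,du<+\infty$; $f$ is twice differentiable almost everywhere with $f',f''\in L_1(\mathbb{R})$; and $\dfrac{nh^2}{\log\log n}\to+\infty$ as $n\to+\infty$. Then for every $M>0$ the estimator $P_{n,b}(z,\alpha)$ converges to $P(z,\alpha)$ uniformly in $z\in[0,M]$ almost surely, i.e. $$\mathbb{P}\Big(\lim_{n\to+\infty}\ \sup_{z\in[0,M]}\big|P_{n,b}(z,\alpha)-P(z,\alpha)\big|=0\Big)=1 .$$
   Context: Fix a real $\alpha$ with $\alpha=0$ or $\alpha\ge 1$. Let $X_1,X_2,\dots$ be i.i.d. real random variables with cumulative distribution function $F$ and continuous, bounded probability density $f$ whose support is contained in $\mathbb{R}_+$. The FGT poverty index is $P(z,\alpha)=\int_0^z\big(\frac{z-x}{z}\big)^{\alpha}f(x)\,dx$ if $z>0$, and $P(z,\alpha)=0$ otherwise. Bandwidth: $h=h(n)>0$ with $h\to0$ as $n\to\infty$. Kernel: $K:\mathbb{R}\to\mathbb{R}$ is such that both $K$ and $K''$ are twice continuously differentiable and integrable on $\mathbb{R}$ (with $\int|K|<\infty$ and $\int|K''|<\infty$); $K$ and $K''$ are bounded; $\int_{\mathbb{R}}K(x)\,dx=1$; $\lim_{x\to\pm\infty}|xK(x)|=0$ and $\lim_{x\to\pm\infty}|xK''(x)|=0$; and $\int_{\mathbb{R}}u^2K(u)\,du$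 is finite. Estimator: for $z>0$, $$P_{n,b}(z,\alpha)=\frac1n\sum_{j=1}^n\sum_{i=0}^{[z/h]}\Big(\frac{z-ih}{z}\Big)^{\alpha}\Big[K\Big(\frac{ih-X_j}{h}\Big)-\frac{h^2}{2}\Big(\int_{\mathbb{R}}u^2K(u)\,du\Big)K''\Big(\frac{ih-X_j}{h}\Big)\Big],$$ where $[\cdot]$ is the integer part and $0^0=1$; $P_{n,b}(z,\alpha)=0$ for $z\le0$. *)

theory Defs
  imports "HOL-Probability.Probability"
begin

definition twice_continuously_differentiable :: "(real \<Rightarrow> real) \<Rightarrow> bool" where
  "twice_continuously_differentiable g \<longleftrightarrow>
     (\<forall>x. g differentiable (at x)) \<and> (\<forall>x. deriv g differentiable (at x)) \<and>
     continuous_on UNIV (deriv (deriv g))"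

(* The first derivative has to exist in a neighbourhood of x, so that the (total) function
   deriv g is a genuine derivative at every point that matters for its differentiability at x. *)
definition twice_differentiable_at :: "(real \<Rightarrow> real) \<Rightarrow> real \<Rightarrow> bool" where
  "twice_differentiable_at g x \<longleftrightarrow>
     (\<forall>\<^sub>F y in nhds x. g differentiable (at y)) \<and> deriv g differentiable (at x)"

(* A finite partition t 0 \<le> ... \<le> t m is extended to a nondecreasing sequence on nat;
   only its first m + 1 terms enter the sum. *)
definition bounded_variation_on_reals :: "(real \<Rightarrow> real) \<Rightarrow> bool" where
  "bounded_variation_on_reals g \<longleftrightarrow>
     (\<exists>B. \<forall>(t :: nat \<Rightarrow> real) m. mono t \<longrightarrow> (\<Sum>i<m. \<bar>g (t (Suc i)) - g (t i)\<bar>) \<le> B)"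

(* ((z - x) / z) to the power \<alpha> with the convention 0^0 = 1, whereas 0 powr 0 = 0.
   Used for 0 \<le> x \<le> z and z > 0 only, so that the base is never negative. *)
definition fgt_weight :: "real \<Rightarrow> real \<Rightarrow> real \<Rightarrow> real" where
  "fgt_weight \<alpha> z x = (if \<alpha> = 0 then 1 else ((z - x) / z) powr \<alpha>)"

definition fgt_index :: "(real \<Rightarrow> real) \<Rightarrow> real \<Rightarrow> real \<Rightarrow> real" where
  "fgt_index f z \<alpha> =
     (if z > 0 then (LINT x:{0..z}|lborel. fgt_weight \<alpha> z x * f x) else 0)"

(* K is the kernel, h the bandwidth at sample size n, and x 1, ..., x n the observed sample. *)
definition fgt_estimator ::
  "(real \<Rightarrow> real) \<Rightarrow> real \<Rightarrow> nat \<Rightarrow> (nat \<Rightarrow> real) \<Rightarrow> real \<Rightarrow> real \<Rightarrow> real" where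
  "fgt_estimator K h n x z \<alpha> =
     (if z > 0 then
        1 / real n * (\<Sum>j = 1..n. \<Sum>i = 0..nat \<lfloor>z / h\<rfloor>.
          fgt_weight \<alpha> z (real i * h) *
          (K ((real i * h - x j) / h)
           - h\<^sup>2 / 2 * (LINT u|lborel. u\<^sup>2 * K u) * deriv (deriv K) ((real i * h - x j) / h)))
      else 0)"

end

theory Submission
  imports Defs
begin

text \<open>
  At a fixed level \<open>z\<close> the weights \<open>fgt_weight \<alpha> z (i h)\<close> lie in \<open>[0, 1]\<close> and do not increase in \<open>i\<close>. By Abel
  summation the random fluctuation of the estimator is therefore at most the maximum, over the
  \<open>O(1/h)\<close> indices \<open>m \<le> M/h\<close>, of the centred averages of \<open>\<phi>\<^sub>m(x) = (\<Sum>i\<le>m. G ((i h - x) / h))\<close>,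
  where \<open>G\<close> is the bias reduced kernel. Since \<open>K\<close> and \<open>K''\<close> are integrable and of bounded variation,
  the \<open>\<phi>\<^sub>m\<close> are bounded uniformly in \<open>m\<close>, \<open>x\<close> and \<open>h\<close>, so Hoeffding's inequality, a union bound over
  \<open>O(n)\<close> indices and the Borel-Cantelli lemma suffice; no law of the iterated logarithm is needed,
  and the bandwidth condition only enters through \<open>1/h \<le> n\<close>. The expectation of the estimator is a
  Riemann sum for \<open>P(z, \<alpha>)\<close> with \<open>f\<close> replaced by a smoothed density that converges to \<open>f\<close> uniformly
  on \<open>[0, M]\<close>.
\<close>

subsection \<open>Summation and convolution estimates\<close>

text \<open>Abel summation: the weighted sum is a combination of the partial sums of
  \<open>d\<close> with the nonnegative coefficients \<open>w i - w (Suc i)\<close> and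
  \<open>w N\<close>, which add up to \<open>w 0\<close>.\<close>

lemma abs_sum_antimono_weights_le:
  fixes w d :: "nat \<Rightarrow> real"
  assumes d: "\<And>m. m \<le> N \<Longrightarrow> \<bar>\<Sum>i\<le>m. d i\<bar> \<le> e"
    and w: "\<And>i. i < N \<Longrightarrow> w (Suc i) \<le> w i" "0 \<le> w N"
  shows "\<bar>\<Sum>i\<le>N. w i * d i\<bar> \<le> w 0 * e"
proof -
  \<comment> \<open>Subtracting the last weight makes the final coefficient vanish, so that raising
    \<open>n\<close> only adds one multiple of a partial sum and the bounds telescope.\<close>
  have *: "\<bar>\<Sum>i\<le>n. w i * d i - w n * d i\<bar> \<le> (w 0 - w n) * e" if "n \<le> N" for n
    using that
  proof (induction n)
    case 0
    then show ?case by simp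
  next
    case (Suc n)
    have "(\<Sum>i\<le>Suc n. w i * d i - w (Suc n) * d i)
        = (\<Sum>i\<le>n. w i * d i - w n * d i) + (w n - w (Suc n)) * (\<Sum>i\<le>n. d i)"
      by (simp add: sum_distrib_left sum.distrib[symmetric] algebra_simps)
    moreover have "\<bar>(w n - w (Suc n)) * (\<Sum>i\<le>n. d i)\<bar> \<le> (w n - w (Suc n)) * e"
      using Suc.prems d[of n] w(1)[of n] by (simp add: abs_mult mult_left_mono)
    ultimately show ?case
      using Suc.IH Suc.prems by (simp add: algebra_simps)
  qed
  have "(\<Sum>i\<le>N. w i * d i) = (\<Sum>i\<le>N. w i * d i - w N * d i) + w N * (\<Sum>i\<le>N. d i)"
    by (simp add: sum_distrib_left sum.distrib[symmetric])
  moreover have "\<bar>w N * (\<Sum>i\<le>N. d i)\<bar> \<le> w N * e"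
    using d[of N] w(2) by (simp add: abs_mult mult_left_mono)
  ultimately show ?thesis
    using *[of N] by (simp add: algebra_simps)
qed

text \<open>Monotonicity of the interleaved sequence encodes
  \<open>s 0 \<le> t 0 \<le> s 1 \<le> t 1 \<le> ...\<close>. The increments from \<open>s i\<close>
  to \<open>t i\<close> are its even-numbered ones; the odd-numbered ones are nonnegative and can be
  added.\<close>

lemma bounded_variation_sum_le:
  assumes "bounded_variation_on_reals g"
  obtains B where "\<And>(s :: nat \<Rightarrow> real) t m. mono (\<lambda>i. if even i then s (i div 2) else t (i div 2)) \<Longrightarrow>
    (\<Sum>i\<le>m. \<bar>g (t i) - g (s i)\<bar>) \<le> B"
proof -
  from assms obtain B where B: "\<And>(t :: nat \<Rightarrow> real) m. mono t \<Longrightarrow>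
      (\<Sum>i<m. \<bar>g (t (Suc i)) - g (t i)\<bar>) \<le> B"
    unfolding bounded_variation_on_reals_def by blast
  have "(\<Sum>i\<le>m. \<bar>g (t i) - g (s i)\<bar>) \<le> B"
    if mono: "mono (\<lambda>i. if even i then s (i div 2) else t (i div 2))" for s t :: "nat \<Rightarrow> real" and m
  proof -
    define v where "v = (\<lambda>i. if even i then s (i div 2) else t (i div 2))"
    have "(\<Sum>i\<le>m. \<bar>g (t i) - g (s i)\<bar>) = (\<Sum>i\<in>(\<lambda>i. 2*i) ` {..m}. \<bar>g (v (Suc i)) - g (v i)\<bar>)"
      by (subst sum.reindex) (auto simp: inj_on_def v_def)
    also have "\<dots> \<le> (\<Sum>i<2*m+1. \<bar>g (v (Suc i)) - g (v i)\<bar>)"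
      by (intro sum_mono2) auto
    also have "\<dots> \<le> B"
      using B[of v "2*m+1"] mono by (simp add: v_def)
    finally show ?thesis .
  qed
  then show ?thesis using that by blast
qed

text \<open>A sum over unit-spaced points is compared with the integral of
  \<open>\<bar>G\<bar>\<close>, at the price of the total variation. Neither quantity sees the shift
  \<open>y\<close>, so kernel sums on a grid of mesh \<open>h\<close> are bounded independently of
  \<open>h\<close> and of the observation.\<close>

lemma bounded_variation_sum_shifts_bounded:
  fixes G :: "real \<Rightarrow> real"
  assumes cont: "continuous_on UNIV G" and int: "integrable lborel G"
    and bv: "bounded_variation_on_reals G"
  obtains C where "\<And>y m. (\<Sum>i\<le>m. \<bar>G (real i - y)\<bar>) \<le> C"
proof -
  from bounded_variation_sum_le[OF bv] obtain B where
    B: "\<And>(s :: nat \<Rightarrow> real) t m. mono (\<lambda>i. if even i then s (i div 2) else t (i div 2)) \<Longrightarrow>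
      (\<Sum>i\<le>m. \<bar>G (t i) - G (s i)\<bar>) \<le> B"
    by blast
  have int': "integrable lborel (\<lambda>x. \<bar>G x\<bar>)"
    using int by simp
  have "(\<Sum>i\<le>m. \<bar>G (real i - y)\<bar>) \<le> (LINT x|lborel. \<bar>G x\<bar>) + B" for y m
  proof -
    \<comment> \<open>The minimum of \<open>\<bar>G\<bar>\<close> over a unit cell is at most its integral there; passing from the
      minimiser to the left end point costs the variation of \<open>G\<close> on the cell.\<close>
    have "\<exists>t\<in>{real i - y..real i - y + 1}. \<forall>x\<in>{real i - y..real i - y + 1}. \<bar>G t\<bar> \<le> \<bar>G x\<bar>" for i
      by (rule continuous_attains_inf)
         (auto intro!: continuous_intros continuous_on_subset[OF cont])
    then obtain t where t: "\<And>i. t i \<in> {real i - y..real i - y + 1}"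
      and t_min: "\<And>i x. x \<in> {real i - y..real i - y + 1} \<Longrightarrow> \<bar>G (t i)\<bar> \<le> \<bar>G x\<bar>"
      by metis
    have sint: "set_integrable lborel {real i - y..<real i - y + 1} (\<lambda>x. \<bar>G x\<bar>)" for i
      unfolding set_integrable_def using int' by (intro integrable_mult_indicator) auto
    have "\<bar>G (t i)\<bar> \<le> (LINT x:{real i - y..<real i - y + 1}|lborel. \<bar>G x\<bar>)" for i
    proof -
      have "\<bar>G (t i)\<bar> = (LINT x:{real i - y..<real i - y + 1}|lborel. \<bar>G (t i)\<bar>)"
        by (simp add: set_lebesgue_integral_def)
      also have "\<dots> \<le> (LINT x:{real i - y..<real i - y + 1}|lborel. \<bar>G x\<bar>)"
        by (rule set_integral_mono[OF _ sint]) (auto intro: t_min simp: set_integrable_def)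
      finally show ?thesis .
    qed
    then have "(\<Sum>i\<le>m. \<bar>G (t i)\<bar>) \<le> (\<Sum>i\<le>m. LINT x:{real i - y..<real i - y + 1}|lborel. \<bar>G x\<bar>)"
      by (intro sum_mono)
    also have "\<dots> = (LINT x:(\<Union>i\<le>m. {real i - y..<real i - y + 1})|lborel. \<bar>G x\<bar>)"
    proof (rule set_integral_finite_Union[symmetric])
      show "disjoint_family_on (\<lambda>i. {real i - y..<real i - y + 1}) {..m}"
        unfolding disjoint_family_on_def
      proof (intro ballI impI)
        fix i j :: nat assume "i \<noteq> j"
        then consider "real i + 1 \<le> real j" | "real j + 1 \<le> real i" by linarith
        then show "{real i - y..<real i - y + 1} \<inter> {real j - y..<real j - y + 1} = {}"
          by cases auto
      qed
    qed (use sint in auto)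
    also have "\<dots> \<le> (LINT x|lborel. \<bar>G x\<bar>)"
      unfolding set_lebesgue_integral_def
      by (intro integral_mono int' integrable_mult_indicator) (auto split: split_indicator)
    finally have 1: "(\<Sum>i\<le>m. \<bar>G (t i)\<bar>) \<le> (LINT x|lborel. \<bar>G x\<bar>)" .
    \<comment> \<open>Left end points and minimisers alternate in increasing order, since
      \<open>t i\<close> lies between \<open>real i - y\<close> and the next left end point.\<close>
    have 2: "(\<Sum>i\<le>m. \<bar>G (t i) - G (real i - y)\<bar>) \<le> B"
    proof (rule B, rule mono_iff_le_Suc[THEN iffD2], rule allI)
      fix n
      show "(if even n then real (n div 2) - y else t (n div 2))
         \<le> (if even (Suc n) then real (Suc n div 2) - y else t (Suc n div 2))"
        using t[of "n div 2"] by (auto elim!: oddE evenE)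
    qed
    have "(\<Sum>i\<le>m. \<bar>G (real i - y)\<bar>) \<le> (\<Sum>i\<le>m. \<bar>G (t i)\<bar> + \<bar>G (t i) - G (real i - y)\<bar>)"
      by (intro sum_mono) linarith
    with 1 2 show ?thesis
      by (simp add: sum.distrib)
  qed
  then show ?thesis using that by blast
qed

text \<open>Where \<open>h * u\<close> is small, uniform continuity of \<open>f\<close> controls the
  difference; elsewhere the bound \<open>2 * B\<close> is paid for by the first absolute moment of
  \<open>G\<close>, which brings in a factor \<open>h\<close>.\<close>

lemma scaled_convolution_uniform_limit:
  fixes f G :: "real \<Rightarrow> real"
  assumes f: "continuous_on UNIV f" and fB: "\<And>x. \<bar>f x\<bar> \<le> B"
    and G: "integrable lborel G" and uG: "integrable lborel (\<lambda>u. u * G u)"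
    and e: "e > 0"
  shows "\<forall>\<^sub>F h in at_right 0. \<forall>x\<in>{0..M}.
    \<bar>(LINT u|lborel. G u * f (x - h * u)) - (LINT u|lborel. G u) * f x\<bar> \<le> e"
proof -
  define I where "I = (LINT u|lborel. \<bar>G u\<bar>)"
  define J where "J = (LINT u|lborel. \<bar>u * G u\<bar>)"
  have IJ: "I \<ge> 0" "J \<ge> 0" by (simp_all add: I_def J_def)
  have B0: "B \<ge> 0" using fB[of 0] by linarith
  \<comment> \<open>This makes \<open>e' * I\<close> at most \<open>e / 2\<close>; adding 1 keeps
    the denominator positive when \<open>I = 0\<close>.\<close>
  define e' where "e' = e / (2 * (I + 1))"
  have e': "e' > 0" using e IJ by (simp add: e'_def)
  \<comment> \<open>The margin 1 leaves room for points within distance \<open>d \<le> 1\<close> of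
    \<open>{0..M}\<close>.\<close>
  have "uniformly_continuous_on {-1..M+1} f"
    by (intro compact_uniformly_continuous continuous_on_subset[OF f]) auto
  then obtain d0 where d0: "d0 > 0"
    "\<And>x y. x \<in> {-1..M+1} \<Longrightarrow> y \<in> {-1..M+1} \<Longrightarrow> dist y x < d0 \<Longrightarrow> dist (f y) (f x) < e'"
    using e' unfolding uniformly_continuous_on_def by metis
  define d where "d = min d0 1"
  have d: "d > 0" "d \<le> 1" "d \<le> d0" using d0 by (auto simp: d_def)
  \<comment> \<open>One inequality for near and far points: the far case follows because
    \<open>\<bar>y - x\<bar> / d\<close> is then at least 1.\<close>
  have close: "\<bar>f y - f x\<bar> \<le> e' + 2 * B * (\<bar>y - x\<bar> / d)" if "x \<in> {0..M}" for x y
  proof (cases "\<bar>y - x\<bar> < d")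
    case True
    then have "dist (f y) (f x) < e'"
      using that d by (intro d0) (auto simp: dist_real_def)
    moreover have "0 \<le> 2 * B * (\<bar>y - x\<bar> / d)"
      using d B0 by simp
    ultimately show ?thesis by (simp add: dist_real_def)
  next
    case False
    then have "2 * B * 1 \<le> 2 * B * (\<bar>y - x\<bar> / d)"
      using d B0 by (intro mult_left_mono) auto
    then show ?thesis using fB[of x] fB[of y] e' by linarith
  qed
  \<comment> \<open>Chosen so that the far contribution
    \<open>2 * (B + 1) * (\<delta> / d) * (J + 1)\<close> equals \<open>e / 2\<close>.\<close>
  define \<delta> where "\<delta> = e * d / (4 * (B + 1) * (J + 1))"
  have \<delta>: "\<delta> > 0" using e d B0 IJ by (simp add: \<delta>_def)
  have meas[measurable]: "f \<in> borel_measurable borel" "G \<in> borel_measurable borel"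
    using f G by (auto intro: borel_measurable_continuous_onI)
  have main: "\<bar>(LINT u|lborel. G u * f (x - h * u)) - (LINT u|lborel. G u) * f x\<bar> \<le> e"
    if h: "0 < h" "h < \<delta>" and x: "x \<in> {0..M}" for h x
  proof -
    have i1: "integrable lborel (\<lambda>u. G u * f (x - h * u))"
    proof (rule Bochner_Integration.integrable_bound)
      show "integrable lborel (\<lambda>u. B * G u)" using G by simp
      show "AE u in lborel. norm (G u * f (x - h * u)) \<le> norm (B * G u)"
        using fB B0 by (auto simp: abs_mult mult.commute[of B] intro!: mult_left_mono)
    qed simp
    have "(LINT u|lborel. G u * f (x - h * u)) - (LINT u|lborel. G u) * f x
        = (LINT u|lborel. G u * (f (x - h * u) - f x))"
      using i1 G by (simp add: right_diff_distrib)
    also have "\<bar>\<dots>\<bar> \<le> (LINT u|lborel. e' * \<bar>G u\<bar> + 2 * B * (h / d) * \<bar>u * G u\<bar>)"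
    proof (rule order_trans[OF integral_abs_bound], rule integral_mono)
      show "integrable lborel (\<lambda>u. \<bar>G u * (f (x - h * u) - f x)\<bar>)"
        using i1 G by (simp add: right_diff_distrib)
      show "integrable lborel (\<lambda>u. e' * \<bar>G u\<bar> + 2 * B * (h / d) * \<bar>u * G u\<bar>)"
        using G uG by simp
      fix u
      have "\<bar>G u\<bar> * \<bar>f (x - h * u) - f x\<bar> \<le> \<bar>G u\<bar> * (e' + 2 * B * (\<bar>h * u\<bar> / d))"
        using close[OF x, of "x - h * u"] by (intro mult_left_mono) auto
      also have "\<dots> = e' * \<bar>G u\<bar> + 2 * B * (h / d) * \<bar>u * G u\<bar>"
        using h by (simp add: abs_mult algebra_simps)
      finally show "\<bar>G u * (f (x - h * u) - f x)\<bar> \<le> e' * \<bar>G u\<bar> + 2 * B * (h / d) * \<bar>u * G u\<bar>"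
        by (simp only: abs_mult)
    qed
    also have "\<dots> = e' * I + 2 * B * (h / d) * J"
      using G uG by (simp add: I_def J_def)
    also have "e' * I \<le> e / 2"
      using e IJ by (simp add: e'_def field_simps)
    also have "2 * B * (h / d) * J \<le> 2 * (B + 1) * (\<delta> / d) * (J + 1)"
      using B0 IJ h d by (intro mult_mono divide_right_mono) auto
    also have "\<dots> = e / 2"
      using d B0 IJ by (simp add: \<delta>_def divide_simps)
    finally show ?thesis by simp
  qed
  show ?thesis
    unfolding eventually_at_right_field using \<delta> main by blast
qed

text \<open>On each cell the error is governed by the drop of \<open>w\<close> and the oscillation
  of \<open>f\<close>. The drops telescope to at most 1, so the bound is the same for all weights of
  this kind, which later makes it uniform in the poverty line. The three terms \<open>B * h\<close>
  come from these drops, from the summand at the last grid point, and from the integral beyond that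
  point.\<close>

lemma riemann_sum_antimono_weight:
  fixes f w :: "real \<Rightarrow> real"
  assumes f: "continuous_on UNIV f" and fB: "\<And>x. \<bar>f x\<bar> \<le> B"
    and w: "continuous_on {0..z} w" "antimono_on {0..z} w" "\<And>x. x \<in> {0..z} \<Longrightarrow> w x \<in> {0..1}"
    and osc: "\<And>x y. x \<in> {0..z} \<Longrightarrow> y \<in> {0..z} \<Longrightarrow> \<bar>x - y\<bar> \<le> h \<Longrightarrow> \<bar>f x - f y\<bar> \<le> e"
    and h: "0 < h" and z: "0 < z"
  shows "\<bar>(\<Sum>i\<le>nat \<lfloor>z / h\<rfloor>. w (real i * h) * (h * f (real i * h))) - integral {0..z} (\<lambda>x. w x * f x)\<bar>
    \<le> 3 * B * h + e * z"
proof -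
  have B0: "B \<ge> 0" using fB[of 0] by linarith
  have e0: "e \<ge> 0" using osc[of 0 0] h z by simp
  let ?g = "\<lambda>x. w x * f x"
  have int: "?g integrable_on {a..b}" if "0 \<le> a" "b \<le> z" for a b
    by (intro integrable_continuous_real continuous_intros continuous_on_subset[OF f]
          continuous_on_subset[OF w(1)]) (use that in auto)
  have g_bd: "\<bar>?g x\<bar> \<le> B" if "x \<in> {0..z}" for x
  proof -
    have "\<bar>w x\<bar> * \<bar>f x\<bar> \<le> 1 * B" using w(3)[OF that] fB[of x] by (intro mult_mono) auto
    then show ?thesis by (simp add: abs_mult)
  qed
  have cell: "\<bar>w a * ((b - a) * f a) - integral {a..b} ?g\<bar> \<le> (B * (w a - w b) + e) * (b - a)"
    if ab: "0 \<le> a" "a \<le> b" "b \<le> z" "b - a \<le> h" for a b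
  proof -
    have wm: "w b \<le> w x" "w x \<le> w a" if "x \<in> {a..b}" for x
      using w(2) ab that unfolding monotone_on_def by auto
    have "((\<lambda>x. w a * f a - ?g x) has_integral ((b - a) * (w a * f a) - integral {a..b} ?g)) {a..b}"
      using has_integral_diff[OF has_integral_const_real[of "w a * f a" a b]
          integrable_integral[OF int[of a b]]] ab by simp
    then have "norm ((b - a) * (w a * f a) - integral {a..b} ?g) \<le> (B * (w a - w b) + e) * measure lborel {a..b}"
    proof (rule has_integral_bound_real[rotated -2])
      show "0 \<le> B * (w a - w b) + e" using B0 e0 wm[of a] ab by simp
      fix x assume x: "x \<in> {a..b} - {}"
      have "w a * f a - ?g x = (w a - w x) * f a + w x * (f a - f x)"
        by (simp add: algebra_simps)
      moreover have "\<bar>(w a - w x) * f a\<bar> \<le> (w a - w b) * B"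
        unfolding abs_mult using wm[of x] fB[of a] x by (intro mult_mono) auto
      moreover have "\<bar>w x * (f a - f x)\<bar> \<le> 1 * e"
        unfolding abs_mult using w(3)[of x] osc[of a x] x ab by (intro mult_mono) auto
      ultimately show "norm (w a * f a - ?g x) \<le> B * (w a - w b) + e"
        by (simp add: mult.commute)
    qed auto
    then show ?thesis using ab by (simp add: mult.left_commute)
  qed
  have ind: "\<bar>(\<Sum>i<n. w (real i * h) * (h * f (real i * h))) - integral {0..real n * h} ?g\<bar>
      \<le> h * B * (w 0 - w (real n * h)) + e * (real n * h)" if "real n * h \<le> z" for n
    using that
  proof (induction n)
    case 0
    then show ?case by simp
  next
    case (Suc n)
    have step: "real (Suc n) * h = real n * h + h" by (simp add: algebra_simps)
    have le: "real n * h \<le> z" using Suc.prems h unfolding step by linarith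
    have "integral {0..real n * h} ?g + integral {real n * h..real (Suc n) * h} ?g
        = integral {0..real (Suc n) * h} ?g"
      using Suc.prems h by (intro Henstock_Kurzweil_Integration.integral_combine int) (auto simp: step)
    moreover have "\<bar>w (real n * h) * (h * f (real n * h)) - integral {real n * h..real (Suc n) * h} ?g\<bar>
        \<le> (B * (w (real n * h) - w (real (Suc n) * h)) + e) * h"
    proof -
      have "real (Suc n) * h - real n * h = h" unfolding step by simp
      then show ?thesis
        using cell[of "real n * h" "real (Suc n) * h"] Suc.prems h by (simp only:) simp
    qed
    ultimately show ?case
      using Suc.IH[OF le] by (simp add: step algebra_simps)
  qed
  define N where "N = nat \<lfloor>z / h\<rfloor>"
  have "0 \<le> z / h" using h z by simp
  then have "real N \<le> z / h" "z / h < real N + 1"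
    unfolding N_def by linarith+
  then have N: "real N * h \<le> z" "z < real N * h + h"
    using h by (simp_all add: field_simps)
  have a: "\<bar>(\<Sum>i<N. w (real i * h) * (h * f (real i * h))) - integral {0..real N * h} ?g\<bar> \<le> B * h + e * z"
  proof -
    have "h * B * (w 0 - w (real N * h)) \<le> h * B * 1"
      using w(3)[of 0] w(3)[of "real N * h"] N h z B0 by (intro mult_left_mono) auto
    moreover have "e * (real N * h) \<le> e * z" using N e0 by (intro mult_left_mono)
    ultimately show ?thesis using ind[OF N(1)] by (simp add: mult.commute)
  qed
  \<comment> \<open>The summand with index \<open>N\<close> stands for a cell cut off at
    \<open>z\<close>, so it is estimated separately from the integral over the remaining
    piece.\<close>
  have b: "\<bar>w (real N * h) * (h * f (real N * h))\<bar> \<le> B * h"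
    using g_bd[of "real N * h"] N h by (simp add: abs_mult mult.left_commute mult_left_mono mult.commute[of B])
  have c: "\<bar>integral {real N * h..z} ?g\<bar> \<le> B * h"
  proof -
    have sub: "x \<in> {0..z}" if "x \<in> {real N * h..z}" for x
      using that h by (auto intro: order_trans[of 0 "real N * h"])
    have "norm (integral {real N * h..z} ?g) \<le> B * measure lborel {real N * h..z}"
      by (rule has_integral_bound_real[OF B0 finite.emptyI integrable_integral[OF int]])
         (use sub g_bd h in \<open>auto simp del: atLeastAtMost_iff\<close>)
    also have "\<dots> \<le> B * h" using N B0 by (intro mult_left_mono) auto
    finally show ?thesis by simp
  qed
  have "integral {0..real N * h} ?g + integral {real N * h..z} ?g = integral {0..z} ?g"
    using N h by (intro Henstock_Kurzweil_Integration.integral_combine int) auto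
  moreover have "(\<Sum>i\<le>N. w (real i * h) * (h * f (real i * h)))
      = (\<Sum>i<N. w (real i * h) * (h * f (real i * h))) + w (real N * h) * (h * f (real N * h))"
    by (simp add: lessThan_Suc_atMost[symmetric])
  ultimately show ?thesis
    unfolding N_def[symmetric] using a b c by linarith
qed

subsection \<open>The FGT weights and the bias\<close>

lemma fgt_weight_continuous_on:
  assumes "\<alpha> = 0 \<or> \<alpha> \<ge> 1" "z > 0"
  shows "continuous_on {0..z} (fgt_weight \<alpha> z)"
proof (cases "\<alpha> = 0")
  case True
  then show ?thesis by (simp add: fgt_weight_def[abs_def])
next
  case False
  then show ?thesis
    unfolding fgt_weight_def[abs_def]
    by (simp, intro continuous_on_powr' continuous_intros ballI) (use assms False in auto)
qed

lemma fgt_weight_antimono_on: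
  assumes "\<alpha> = 0 \<or> \<alpha> \<ge> 1" "z > 0"
  shows "antimono_on {0..z} (fgt_weight \<alpha> z)"
  using assms by (auto simp: monotone_on_def fgt_weight_def intro!: powr_mono2 divide_right_mono)

lemma fgt_weight_in_unit_interval:
  assumes "\<alpha> = 0 \<or> \<alpha> \<ge> 1" "z > 0" "x \<in> {0..z}"
  shows "fgt_weight \<alpha> z x \<in> {0..1}"
  using assms by (auto simp: fgt_weight_def intro!: powr_le1)

lemma fgt_index_eq_integral:
  assumes "\<alpha> = 0 \<or> \<alpha> \<ge> 1" "z > 0" "continuous_on UNIV f"
  shows "fgt_index f z \<alpha> = integral {0..z} (\<lambda>x. fgt_weight \<alpha> z x * f x)"
proof -
  have "set_integrable lborel {0..z} (\<lambda>x. fgt_weight \<alpha> z x * f x)"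
    by (intro borel_integrable_atLeastAtMost' continuous_intros fgt_weight_continuous_on
          continuous_on_subset[OF assms(3)] assms) auto
  then show ?thesis
    using assms by (simp add: fgt_index_def set_borel_integral_eq_integral(2))
qed

section \<open>Right-continuity in the poverty line\<close>

lemma fgt_weight_tendsto_at_right:
  assumes "\<alpha> = 0 \<or> \<alpha> \<ge> 1" "z > 0" "x \<le> z"
  shows "((\<lambda>y. fgt_weight \<alpha> y x) \<longlongrightarrow> fgt_weight \<alpha> z x) (at_right z)"
proof (cases "\<alpha> = 0")
  case True
  then show ?thesis by (simp add: fgt_weight_def)
next
  case False
  have "((\<lambda>y. ((y - x) / y) powr \<alpha>) \<longlongrightarrow> ((z - x) / z) powr \<alpha>) (at_right z)"
  \<comment> \<open>At \<open>x = z\<close> the base tends to 0, and the rule then asks for a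
    positive exponent and an eventually nonnegative base; the latter holds because \<open>y\<close>
    approaches \<open>z\<close> from the right.\<close>
  proof (rule tendsto_powr')
    show "((\<lambda>y. (y - x) / y) \<longlongrightarrow> (z - x) / z) (at_right z)"
      using assms by (auto intro!: tendsto_eq_intros)
    have "\<forall>\<^sub>F y in at_right z. y > z" by (simp add: eventually_at_right_less)
    then have "\<forall>\<^sub>F y in at_right z. 0 \<le> (y - x) / y"
      by eventually_elim (use assms in simp)
    then show "(z - x) / z \<noteq> 0 \<or> 0 < \<alpha> \<and> (\<forall>\<^sub>F y in at_right z. 0 \<le> (y - x) / y)"
      using assms False by auto
  qed simp
  then show ?thesis using False by (simp add: fgt_weight_def)
qed

text \<open>Dominated convergence with majorant \<open>\<bar>f\<bar>\<close> on
  \<open>{0..z+1}\<close>: for \<open>x \<le> z\<close> the weights converge, and for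
  \<open>x > z\<close> the indicators eventually vanish.\<close>

lemma fgt_index_tendsto_at_right:
  assumes \<alpha>: "\<alpha> = 0 \<or> \<alpha> \<ge> 1" and z: "z > 0" and f: "continuous_on UNIV f"
  shows "((\<lambda>y. fgt_index f y \<alpha>) \<longlongrightarrow> fgt_index f z \<alpha>) (at_right z)"
proof (rule tendsto_at_right_sequentially[of z "z + 1"])
  fix S :: "nat \<Rightarrow> real"
  assume S: "\<And>n. z < S n" "\<And>n. S n < z + 1" "decseq S" "S \<longlonglongrightarrow> z"
  have [measurable]: "f \<in> borel_measurable borel"
    using f by (rule borel_measurable_continuous_onI)
  have wm[measurable]: "fgt_weight \<alpha> y \<in> borel_measurable borel" for y
    unfolding fgt_weight_def[abs_def] by measurable
  have "(\<lambda>n. LINT x|lborel. indicator {0..S n} x * (fgt_weight \<alpha> (S n) x * f x))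
      \<longlonglongrightarrow> (LINT x|lborel. indicator {0..z} x * (fgt_weight \<alpha> z x * f x))"
  proof (rule integral_dominated_convergence[where w = "\<lambda>x. indicator {0..z+1} x * \<bar>f x\<bar>"])
    have "set_integrable lborel {0..z+1} (\<lambda>x. \<bar>f x\<bar>)"
      by (intro borel_integrable_atLeastAtMost' continuous_intros continuous_on_subset[OF f]) auto
    then show "integrable lborel (\<lambda>x. indicator {0..z+1} x * \<bar>f x\<bar>)"
      by (simp add: set_integrable_def)
    show "AE x in lborel. norm (indicator {0..S n} x * (fgt_weight \<alpha> (S n) x * f x))
        \<le> indicator {0..z+1} x * \<bar>f x\<bar>" for n
    proof (rule AE_I2)
      fix x
      show "norm (indicator {0..S n} x * (fgt_weight \<alpha> (S n) x * f x)) \<le> indicator {0..z+1} x * \<bar>f x\<bar>"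
      proof (cases "x \<in> {0..S n}")
        case True
        then have "fgt_weight \<alpha> (S n) x \<in> {0..1}"
          using \<alpha> z S(1)[of n] by (intro fgt_weight_in_unit_interval) auto
        then have "\<bar>fgt_weight \<alpha> (S n) x\<bar> * \<bar>f x\<bar> \<le> 1 * \<bar>f x\<bar>"
          by (intro mult_right_mono) auto
        then show ?thesis using True S(2)[of n] by (simp add: abs_mult)
      qed auto
    qed
    show "AE x in lborel. (\<lambda>n. indicator {0..S n} x * (fgt_weight \<alpha> (S n) x * f x))
        \<longlonglongrightarrow> indicator {0..z} x * (fgt_weight \<alpha> z x * f x)"
    proof (rule AE_I2)
      fix x
      consider "x < 0" | "0 \<le> x" "x \<le> z" | "x > z" "x \<ge> 0" by linarith
      then show "(\<lambda>n. indicator {0..S n} x * (fgt_weight \<alpha> (S n) x * f x))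
        \<longlonglongrightarrow> indicator {0..z} x * (fgt_weight \<alpha> z x * f x)"
      proof cases
        case 2
        have "S n \<noteq> z" for n using S(1)[of n] by simp
        then have "(\<lambda>n. fgt_weight \<alpha> (S n) x) \<longlonglongrightarrow> fgt_weight \<alpha> z x"
          by (intro filterlim_compose[OF fgt_weight_tendsto_at_right[OF \<alpha> z 2(2)]])
             (use S in \<open>auto simp: filterlim_at\<close>)
        moreover have "x \<le> S n" for n using 2 S(1)[of n] by linarith
        ultimately show ?thesis using 2 by (auto intro: tendsto_intros)
      next
        case 3
        then have "\<forall>\<^sub>F n in sequentially. S n < x"
          using S(4) by (simp add: order_tendsto_iff)
        then have "\<forall>\<^sub>F n in sequentially. indicator {0..S n} x * (fgt_weight \<alpha> (S n) x * f x) = 0"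
          by eventually_elim auto
        then show ?thesis using 3 by (simp add: tendsto_eventually)
      qed auto
    qed
  qed measurable
  moreover have "S n > 0" for n using z S(1)[of n] by linarith
  ultimately show "(\<lambda>n. fgt_index f (S n) \<alpha>) \<longlonglongrightarrow> fgt_index f z \<alpha>"
    using z by (simp add: fgt_index_def set_lebesgue_integral_def)
qed simp

text \<open>A new summand enters whenever \<open>z\<close> reaches a multiple of \<open>h\<close>,
  with weight 1 if \<alpha> = 0, so only continuity from the right can be expected. It holds because
  the number of summands stays constant on \<open>z \<le> y < (N + 1) * h\<close>.\<close>

lemma fgt_estimator_tendsto_at_right:
  assumes \<alpha>: "\<alpha> = 0 \<or> \<alpha> \<ge> 1" and z: "z > 0" and h: "h > 0"
  shows "((\<lambda>y. fgt_estimator K h n x y \<alpha>) \<longlongrightarrow> fgt_estimator K h n x z \<alpha>) (at_right z)"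
proof -
  define N where "N = nat \<lfloor>z / h\<rfloor>"
  have zh: "0 \<le> z / h" using z h by simp
  then have N: "real N \<le> z / h" "z / h < real N + 1"
    unfolding N_def by linarith+
  define g where "g = (\<lambda>y. 1 / real n * (\<Sum>j = 1..n. \<Sum>i = 0..N. fgt_weight \<alpha> y (real i * h) *
          (K ((real i * h - x j) / h)
           - h\<^sup>2 / 2 * (LINT u|lborel. u\<^sup>2 * K u) * deriv (deriv K) ((real i * h - x j) / h))))"
  have "\<forall>\<^sub>F y in at_right z. y < (real N + 1) * h"
    using N(2) h by (intro eventually_at_rightI[of z "(real N + 1) * h"]) (auto simp: field_simps)
  moreover have "\<forall>\<^sub>F y in at_right z. y > z" by (simp add: eventually_at_right_less)
  ultimately have eq: "\<forall>\<^sub>F y in at_right z. g y = fgt_estimator K h n x y \<alpha>"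
  proof eventually_elim
    case (elim y)
    then have "y / h < real N + 1" "z / h < y / h"
      using h by (simp_all add: field_simps)
    with N zh have "nat \<lfloor>y / h\<rfloor> = N" by linarith
    then show ?case using elim z by (simp add: g_def fgt_estimator_def)
  qed
  have "(g \<longlongrightarrow> g z) (at_right z)"
    unfolding g_def
  proof (intro tendsto_intros fgt_weight_tendsto_at_right \<alpha> z)
    fix i assume "i \<in> {0..N}"
    then have "real i \<le> z / h" using N by auto
    then show "real i * h \<le> z" using h by (simp add: field_simps)
  qed
  moreover have "g z = fgt_estimator K h n x z \<alpha>"
    using z by (simp add: g_def fgt_estimator_def N_def)
  ultimately show ?thesis using tendsto_cong[OF eq] by simp
qed

section \<open>The smoothed density and the bias of the estimator\<close>

definition bias_reduced_kernel :: "(real \<Rightarrow> real) \<Rightarrow> real \<Rightarrow> real \<Rightarrow> real" where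
  "bias_reduced_kernel K h u =
     K u - h\<^sup>2 / 2 * (LINT u|lborel. u\<^sup>2 * K u) * deriv (deriv K) u"

text \<open>For a random variable \<open>X\<close> with density \<open>f\<close>,
  \<open>h * smoothed_density K f h x\<close> is the expectation of
  \<open>bias_reduced_kernel K h ((x - X) / h)\<close>.\<close>

definition smoothed_density :: "(real \<Rightarrow> real) \<Rightarrow> (real \<Rightarrow> real) \<Rightarrow> real \<Rightarrow> real \<Rightarrow> real" where
  "smoothed_density K f h x = (LINT u|lborel. bias_reduced_kernel K h u * f (x - h * u))"

text \<open>The \<open>K\<close> part is an approximate identity because \<open>K\<close> has
  integral 1. The correction carries the factor \<open>h\<^sup>2\<close> and an integral bounded by
  \<open>I * B\<close>, hence vanishes uniformly in \<open>x\<close>.\<close>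

lemma smoothed_density_uniform_limit:
  fixes f K :: "real \<Rightarrow> real"
  assumes f: "continuous_on UNIV f" and fB: "\<And>x. \<bar>f x\<bar> \<le> B"
    and K: "integrable lborel K" "integrable lborel (\<lambda>u. u * K u)" "(LINT u|lborel. K u) = 1"
    and K'': "integrable lborel (deriv (deriv K))"
    and e: "e > 0"
  shows "\<forall>\<^sub>F h in at_right 0. \<forall>x\<in>{0..M}. \<bar>smoothed_density K f h x - f x\<bar> \<le> e"
proof -
  define c where "c = (LINT u|lborel. u\<^sup>2 * K u)"
  define I where "I = (LINT u|lborel. \<bar>deriv (deriv K) u\<bar>)"
  have [measurable]: "f \<in> borel_measurable borel" "K \<in> borel_measurable borel"
    "deriv (deriv K) \<in> borel_measurable borel"
    using f K(1) K'' by (auto intro: borel_measurable_continuous_onI)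
  have B0: "B \<ge> 0" using fB[of 0] by linarith
  have int: "integrable lborel (\<lambda>u. G u * f (x - h * u))" if "integrable lborel G"
    for G :: "real \<Rightarrow> real" and h x
  proof (rule Bochner_Integration.integrable_bound)
    show "integrable lborel (\<lambda>u. B * G u)" using that by simp
    show "AE u in lborel. norm (G u * f (x - h * u)) \<le> norm (B * G u)"
      using fB B0 by (auto simp: abs_mult mult.commute[of B] intro!: mult_left_mono)
    have [measurable]: "G \<in> borel_measurable borel" using that by auto
    show "(\<lambda>u. G u * f (x - h * u)) \<in> borel_measurable lborel" by measurable
  qed
  have lim: "((\<lambda>h. h\<^sup>2 / 2 * \<bar>c\<bar> * (I * B)) \<longlongrightarrow> 0) (at_right 0)"
    by (auto intro!: tendsto_eq_intros)
  have "\<forall>\<^sub>F h in at_right 0. h\<^sup>2 / 2 * \<bar>c\<bar> * (I * B) < e / 2"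
    using order_tendstoD(2)[OF lim, of "e / 2"] e by simp
  moreover have "\<forall>\<^sub>F h in at_right 0. \<forall>x\<in>{0..M}.
      \<bar>(LINT u|lborel. K u * f (x - h * u)) - (LINT u|lborel. K u) * f x\<bar> \<le> e / 2"
    using e by (intro scaled_convolution_uniform_limit[OF f fB K(1,2)]) auto
  ultimately show ?thesis
  proof eventually_elim
    case (elim h)
    show ?case
    proof
      fix x assume x: "x \<in> {0..M}"
      have "smoothed_density K f h x = (LINT u|lborel. K u * f (x - h * u)
          - h\<^sup>2 / 2 * c * (deriv (deriv K) u * f (x - h * u)))"
        by (simp add: smoothed_density_def bias_reduced_kernel_def c_def algebra_simps)
      also have "\<dots> = (LINT u|lborel. K u * f (x - h * u))
          - h\<^sup>2 / 2 * c * (LINT u|lborel. deriv (deriv K) u * f (x - h * u))"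
        by (simp only: integral_mult_right_zero
              Bochner_Integration.integral_diff[OF int[OF K(1)] integrable_mult_right[OF int[OF K'']]])
      finally have "smoothed_density K f h x - f x = ((LINT u|lborel. K u * f (x - h * u)) - f x)
          - h\<^sup>2 / 2 * c * (LINT u|lborel. deriv (deriv K) u * f (x - h * u))" by simp
      moreover have "\<bar>(LINT u|lborel. K u * f (x - h * u)) - f x\<bar> \<le> e / 2"
        using elim(2) x K(3) by simp
      moreover have "\<bar>LINT u|lborel. deriv (deriv K) u * f (x - h * u)\<bar> \<le> I * B"
      proof -
        have "\<bar>LINT u|lborel. deriv (deriv K) u * f (x - h * u)\<bar>
            \<le> (LINT u|lborel. \<bar>deriv (deriv K) u\<bar> * B)"
          using K'' fB
          by (intro order_trans[OF integral_abs_bound integral_mono[OF integrable_abs[OF int[OF K'']]]])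
             (auto simp: abs_mult intro!: mult_left_mono)
        then show ?thesis by (simp add: I_def)
      qed
      then have "\<bar>h\<^sup>2 / 2 * c * (LINT u|lborel. deriv (deriv K) u * f (x - h * u))\<bar> \<le> h\<^sup>2 / 2 * \<bar>c\<bar> * (I * B)"
        by (simp add: abs_mult mult_left_mono)
      ultimately show "\<bar>smoothed_density K f h x - f x\<bar> \<le> e"
        using elim(1) by linarith
    qed
  qed
qed

text \<open>Two errors are added: replacing the smoothed density by \<open>f\<close> at the grid
  points, and replacing the resulting Riemann sum by the integral. Both bounds depend on
  \<open>z\<close> only through \<open>z \<le> M\<close>.\<close>

lemma fgt_bias_uniform_limit:
  fixes f K :: "real \<Rightarrow> real"
  assumes \<alpha>: "\<alpha> = 0 \<or> \<alpha> \<ge> 1" and M: "M > 0"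
    and f: "continuous_on UNIV f" and fB: "\<And>x. \<bar>f x\<bar> \<le> B"
    and K: "integrable lborel K" "integrable lborel (\<lambda>u. u * K u)" "(LINT u|lborel. K u) = 1"
    and K'': "integrable lborel (deriv (deriv K))"
    and e: "e > 0"
  shows "\<forall>\<^sub>F h in at_right 0. \<forall>z\<in>{0<..M}.
    \<bar>(\<Sum>i\<le>nat \<lfloor>z / h\<rfloor>. fgt_weight \<alpha> z (real i * h) * (h * smoothed_density K f h (real i * h)))
      - fgt_index f z \<alpha>\<bar> \<le> e"
proof -
  have B0: "B \<ge> 0" using fB[of 0] by linarith
  \<comment> \<open>Each of the two errors will be at most \<open>(M + 1) * e1\<close>, which is
    half of \<open>e\<close>.\<close>
  define e1 where "e1 = e / (2 * (M + 1))"
  have e1: "e1 > 0" using e M by (simp add: e1_def)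
  have "uniformly_continuous_on {0..M} f"
    by (intro compact_uniformly_continuous continuous_on_subset[OF f]) auto
  then obtain d where d: "d > 0"
    "\<And>x y. x \<in> {0..M} \<Longrightarrow> y \<in> {0..M} \<Longrightarrow> dist y x < d \<Longrightarrow> dist (f y) (f x) < e1"
    using e1 unfolding uniformly_continuous_on_def by metis
  have lim: "((\<lambda>h. h) \<longlongrightarrow> 0) (at_right (0::real))" "((\<lambda>h. 3 * B * h) \<longlongrightarrow> 0) (at_right 0)"
    by (auto intro!: tendsto_eq_intros)
  have "\<forall>\<^sub>F h in at_right 0. h < (1::real)" "\<forall>\<^sub>F h in at_right 0. h < d" "\<forall>\<^sub>F h in at_right 0. 3 * B * h < e1"
    using order_tendstoD(2)[OF lim(1), of 1] order_tendstoD(2)[OF lim(1), of d]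
      order_tendstoD(2)[OF lim(2), of e1] d e1 by auto
  moreover have "\<forall>\<^sub>F h in at_right 0. h > (0::real)" by (simp add: eventually_at_right_less)
  moreover have "\<forall>\<^sub>F h in at_right 0. \<forall>x\<in>{0..M}. \<bar>smoothed_density K f h x - f x\<bar> \<le> e1"
    by (rule smoothed_density_uniform_limit[OF f fB K K'' e1])
  ultimately show ?thesis
  proof eventually_elim
    case (elim h)
    show ?case
    proof
      fix z assume z: "z \<in> {0<..M}"
      define N where "N = nat \<lfloor>z / h\<rfloor>"
      have "0 \<le> z / h" using z elim by simp
      then have "real N \<le> z / h" unfolding N_def by linarith
      then have N: "real N * h \<le> z" using elim by (simp add: field_simps)
      have ih: "real i * h \<in> {0..z}" if "i \<le> N" for i
      proof -
        have "real i * h \<le> real N * h" using that elim by (intro mult_right_mono) auto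
        moreover have "0 \<le> real i * h" using elim by simp
        ultimately show ?thesis by (metis N atLeastAtMost_iff order_trans)
      qed
      let ?w = "fgt_weight \<alpha> z"
      have "\<bar>(\<Sum>i\<le>N. ?w (real i * h) * (h * smoothed_density K f h (real i * h)))
          - (\<Sum>i\<le>N. ?w (real i * h) * (h * f (real i * h)))\<bar>
          = \<bar>\<Sum>i\<le>N. ?w (real i * h) * (h * (smoothed_density K f h (real i * h) - f (real i * h)))\<bar>"
        by (simp add: sum_subtractf algebra_simps)
      also have "\<dots> \<le> (\<Sum>i\<le>N. \<bar>?w (real i * h) * (h * (smoothed_density K f h (real i * h) - f (real i * h)))\<bar>)"
        by (rule sum_abs)
      also have "\<dots> \<le> (\<Sum>i\<le>N. 1 * (h * e1))"
      proof (rule sum_mono)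
        fix i assume "i \<in> {..N}"
        then have i: "real i * h \<in> {0..z}" by (intro ih) simp
        have "\<bar>smoothed_density K f h (real i * h) - f (real i * h)\<bar> \<le> e1"
          using elim i z by auto
        moreover have "?w (real i * h) \<in> {0..1}"
          using \<alpha> z i by (intro fgt_weight_in_unit_interval) auto
        ultimately show "\<bar>?w (real i * h) * (h * (smoothed_density K f h (real i * h) - f (real i * h)))\<bar> \<le> 1 * (h * e1)"
          unfolding abs_mult using elim e1 by (intro mult_mono) auto
      qed
      \<comment> \<open>There are \<open>N + 1\<close> grid points; the extra \<open>h\<close> is
        absorbed by \<open>h < 1\<close>.\<close>
      also have "\<dots> = (real N * h + h) * e1" by (simp add: algebra_simps)
      also have "\<dots> \<le> (M + 1) * e1" using N z elim e1 by (intro mult_right_mono) auto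
      finally have 1: "\<bar>(\<Sum>i\<le>N. ?w (real i * h) * (h * smoothed_density K f h (real i * h)))
          - (\<Sum>i\<le>N. ?w (real i * h) * (h * f (real i * h)))\<bar> \<le> (M + 1) * e1" .
      have "\<bar>(\<Sum>i\<le>N. ?w (real i * h) * (h * f (real i * h))) - integral {0..z} (\<lambda>x. ?w x * f x)\<bar>
          \<le> 3 * B * h + e1 * z"
        unfolding N_def
      proof (rule riemann_sum_antimono_weight[OF f fB])
        fix x y assume "x \<in> {0..z}" "y \<in> {0..z}" "\<bar>x - y\<bar> \<le> h"
        then have "dist (f x) (f y) < e1" using z elim by (intro d) (auto simp: dist_real_def)
        then show "\<bar>f x - f y\<bar> \<le> e1" by (simp add: dist_real_def)
      qed (use \<alpha> z elim in \<open>auto intro!: fgt_weight_continuous_on fgt_weight_antimono_on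
             simp del: atLeastAtMost_iff intro: fgt_weight_in_unit_interval\<close>)
      moreover have "e1 * z \<le> e1 * M" using z e1 by (intro mult_left_mono) auto
      ultimately have 2: "\<bar>(\<Sum>i\<le>N. ?w (real i * h) * (h * f (real i * h))) - fgt_index f z \<alpha>\<bar> \<le> e1 + e1 * M"
        using elim z fgt_index_eq_integral[OF \<alpha> _ f, of z] by simp
      have "(M + 1) * e1 + (e1 + e1 * M) = e"
        using M by (simp add: e1_def divide_simps) (simp add: algebra_simps)
      with 1 2 show "\<bar>(\<Sum>i\<le>nat \<lfloor>z / h\<rfloor>. ?w (real i * h) * (h * smoothed_density K f h (real i * h)))
          - fgt_index f z \<alpha>\<bar> \<le> e"
        unfolding N_def by linarith
    qed
  qed
qed

subsection \<open>Uniform deviations of bounded averages\<close>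

text \<open>Each index \<open>m\<close> fails with probability at most \<open>2 * q ^ n\<close>, and
  there are at most \<open>L * n + 1\<close> indices, so the failure probabilities are summable. The
  functions and their number may change with \<open>n\<close>, since Borel-Cantelli uses only these
  probabilities.\<close>

lemma (in prob_space) AE_eventually_uniform_deviation_less:
  fixes X :: "nat \<Rightarrow> 'a \<Rightarrow> real" and \<phi> :: "nat \<Rightarrow> nat \<Rightarrow> real \<Rightarrow> real" and r :: "nat \<Rightarrow> nat"
  assumes indep: "indep_vars (\<lambda>_. borel) X {1..}"
    and ident: "\<And>j. j \<ge> 1 \<Longrightarrow> distr M borel (X j) = distr M borel (X 1)"
    and meas[measurable]: "\<And>n m. \<phi> n m \<in> borel_measurable borel"
    and bound: "\<forall>\<^sub>F n in sequentially. \<forall>m\<le>r n. \<forall>x. \<bar>\<phi> n m x\<bar> \<le> C"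
    and r: "\<forall>\<^sub>F n in sequentially. real (r n) \<le> L * real n"
    and e: "e > 0"
  shows "AE \<omega> in M. \<forall>\<^sub>F n in sequentially. \<forall>m\<le>r n.
    \<bar>(\<Sum>j = 1..n. \<phi> n m (X j \<omega>)) / real n - expectation (\<lambda>\<omega>. \<phi> n m (X 1 \<omega>))\<bar> < e"
proof -
  have X[measurable]: "X j \<in> borel_measurable M" if "j \<ge> 1" for j
    using indep that unfolding indep_vars_def by auto
  \<comment> \<open>The maximum with 1 gives the range \<open>{- D..D}\<close> positive length even
    if \<open>C\<close> is not positive.\<close>
  define D where "D = max C 1"
  have D: "D > 0" "C \<le> D" by (auto simp: D_def)
  \<comment> \<open>Hoeffding's exponent \<open>-2 * n * e\<^sup>2 / (2 * D)\<^sup>2\<close> is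
    \<open>n\<close> times the exponent here.\<close>
  define q where "q = exp (- e\<^sup>2 / (2 * D\<^sup>2))"
  have q: "0 < q" "q < 1" using e D by (auto simp: q_def)
  define dev where "dev = (\<lambda>n m \<omega>. \<bar>(\<Sum>j = 1..n. \<phi> n m (X j \<omega>)) / real n
    - expectation (\<lambda>\<omega>. \<phi> n m (X 1 \<omega>))\<bar>)"
  have [measurable]: "dev n m \<in> borel_measurable M" for n m
    unfolding dev_def by measurable
  define A where "A = (\<lambda>n. {\<omega> \<in> space M. \<exists>m\<in>{..r n}. dev n m \<omega> \<ge> e})"
  have A[measurable]: "A n \<in> sets M" for n
    unfolding A_def by measurable
  have dev_prob: "prob {\<omega> \<in> space M. dev n m \<omega> \<ge> e} \<le> 2 * q ^ n"
    if n: "n \<ge> 1" and bd: "\<And>x. \<bar>\<phi> n m x\<bar> \<le> C" for n m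
  proof -
    interpret H: Hoeffding_ineq_iid M "{1..n}" "\<lambda>j \<omega>. \<phi> n m (X j \<omega>)" "\<lambda>\<omega>. \<phi> n m (X 1 \<omega>)"
      "- D" D "expectation (\<lambda>\<omega>. \<phi> n m (X 1 \<omega>))"
    proof unfold_locales
      show "indep_vars (\<lambda>_. borel) (\<lambda>j \<omega>. \<phi> n m (X j \<omega>)) {1..n}"
        by (rule indep_vars_compose2[OF indep_vars_subset[OF indep]]) auto
      show "distr M borel (\<lambda>\<omega>. \<phi> n m (X j \<omega>)) = distr M borel (\<lambda>\<omega>. \<phi> n m (X 1 \<omega>))"
        if "j \<in> {1..n}" for j
      proof -
        have "distr M borel (\<lambda>\<omega>. \<phi> n m (X i \<omega>)) = distr (distr M borel (X i)) borel (\<phi> n m)"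
          if "i \<ge> 1" for i
          using that by (subst distr_distr) (auto simp: comp_def)
        then show ?thesis using that ident[of j] by simp
      qed
      show "AE \<omega> in M. \<phi> n m (X 1 \<omega>) \<in> {- D..D}"
      proof (rule AE_I2)
        fix \<omega>
        show "\<phi> n m (X 1 \<omega>) \<in> {- D..D}" using bd[of "X 1 \<omega>"] D by (simp add: abs_le_iff)
      qed
    qed auto
    have "prob {\<omega> \<in> space M. dev n m \<omega> \<ge> e} \<le> 2 * exp (-2 * real n * e\<^sup>2 / (D - (-D))\<^sup>2)"
      using H.Hoeffding_ineq_abs_ge'[of e] e D n by (simp add: dev_def del: H.expectation_X)
    also have "-2 * real n * e\<^sup>2 / (D - (-D))\<^sup>2 = real n * (- e\<^sup>2 / (2 * D\<^sup>2))"
      using D by (simp add: field_simps power2_eq_square)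
    finally show ?thesis by (simp only: q_def exp_of_nat_mult)
  qed
  have A_prob: "\<forall>\<^sub>F n in sequentially. prob (A n) \<le> 2 * (L * (real n * q ^ n) + q ^ n)"
    using bound r eventually_ge_at_top[of 1]
  proof eventually_elim
    case (elim n)
    have "prob (A n) = prob (\<Union>m\<in>{..r n}. {\<omega> \<in> space M. dev n m \<omega> \<ge> e})"
      by (rule arg_cong[where f = prob]) (auto simp: A_def)
    also have "\<dots> \<le> (\<Sum>m\<in>{..r n}. prob {\<omega> \<in> space M. dev n m \<omega> \<ge> e})"
      by (rule finite_measure_subadditive_finite) auto
    also have "\<dots> \<le> (\<Sum>m\<in>{..r n}. 2 * q ^ n)"
      using elim by (intro sum_mono dev_prob) auto
    also have "\<dots> = (real (r n) + 1) * (2 * q ^ n)" by simp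
    also have "\<dots> \<le> (L * real n + 1) * (2 * q ^ n)"
      using elim q by (intro mult_right_mono) auto
    finally show ?case by (simp add: algebra_simps)
  qed
  have "summable (\<lambda>n. real n * q ^ n)"
  proof -
    \<comment> \<open>Termwise derivative of the geometric series.\<close>
    have "summable (\<lambda>n. diffs (\<lambda>_. 1) n * q ^ n)"
      by (rule termdiff_converges[of q 1]) (use q in \<open>auto intro: summable_geometric\<close>)
    then have "summable (\<lambda>n. real (Suc n) * q ^ n * q)"
      by (intro summable_mult2) (simp add: diffs_def)
    then have "summable (\<lambda>n. real (Suc n) * q ^ Suc n)" by (simp add: mult_ac)
    then show ?thesis by (rule summable_Suc_iff[THEN iffD1])
  qed
  then have "summable (\<lambda>n. 2 * (L * (real n * q ^ n) + q ^ n))"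
    using q by (intro summable_mult summable_add summable_geometric) auto
  then have "summable (\<lambda>n. prob (A n))"
    by (rule summable_comparison_test_ev[rotated]) (use A_prob in \<open>auto elim: eventually_mono\<close>)
  then have "AE \<omega> in M. \<forall>\<^sub>F n in sequentially. \<omega> \<in> space M - A n"
    by (intro borel_cantelli_AE1) (auto simp: less_top[symmetric])
  then show ?thesis
  proof (rule AE_mp, intro AE_I2 impI)
    fix \<omega> assume "\<omega> \<in> space M" and "\<forall>\<^sub>F n in sequentially. \<omega> \<in> space M - A n"
    from this(2) show "\<forall>\<^sub>F n in sequentially. \<forall>m\<le>r n.
      \<bar>(\<Sum>j = 1..n. \<phi> n m (X j \<omega>)) / real n - expectation (\<lambda>\<omega>. \<phi> n m (X 1 \<omega>))\<bar> < e"
      by eventually_elim (auto simp: A_def dev_def not_le)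
  qed
qed

subsection \<open>Measurability of the supremum\<close>

text \<open>A value above the countable supremum would persist on an interval to the right, which
  contains a rational. The end points are adjoined separately: the estimator is 0 at
  \<open>z = 0\<close> by convention but in general has another limit from the right, and to the
  right of \<open>M\<close> there are no admissible points.\<close>

lemma cSUP_right_continuous_eq_cSUP_rationals:
  fixes g :: "real \<Rightarrow> real"
  assumes M: "0 \<le> M" and bdd: "bdd_above (g ` {0..M})"
    and right: "\<And>z. 0 < z \<Longrightarrow> z < M \<Longrightarrow> (g \<longlongrightarrow> g z) (at_right z)"
  shows "(SUP z\<in>{0..M}. g z) = (SUP z\<in>{0..M} \<inter> (\<rat> \<union> {0, M}). g z)"
proof (rule antisym)
  let ?Q = "{0..M} \<inter> (\<rat> \<union> {0, M})"
  have bddQ: "bdd_above (g ` ?Q)" by (rule bdd_above_mono[OF bdd]) auto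
  show "(SUP z\<in>{0..M}. g z) \<le> (SUP z\<in>?Q. g z)"
  proof (rule cSUP_least)
    fix z assume z: "z \<in> {0..M}"
    show "g z \<le> (SUP z\<in>?Q. g z)"
    proof (cases "z \<in> {0, M}")
      case True
      then show ?thesis using z by (intro cSUP_upper bddQ) auto
    next
      case False
      with z have z': "0 < z" "z < M" by auto
      show ?thesis
      proof (rule ccontr)
        assume "\<not> ?thesis"
        then have "\<forall>\<^sub>F y in at_right z. g y > (SUP z\<in>?Q. g z)"
          by (intro order_tendstoD[OF right[OF z']]) simp
        then obtain b where b: "b > z" "\<And>y. y > z \<Longrightarrow> y < b \<Longrightarrow> g y > (SUP z\<in>?Q. g z)"
          unfolding eventually_at_right_field by blast
        obtain q where q: "q \<in> \<rat>" "z < q" "q < min b M"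
          using Rats_dense_in_real[of z "min b M"] b z' by auto
        then have "g q \<le> (SUP z\<in>?Q. g z)"
          using z' by (intro cSUP_upper bddQ) auto
        with b(2)[of q] q show False by simp
      qed
    qed
  qed (use M in auto)
  show "(SUP z\<in>?Q. g z) \<le> (SUP z\<in>{0..M}. g z)"
    by (rule cSUP_subset_mono[OF _ bdd]) (use M in auto)
qed

lemma abs_fgt_index_le:
  assumes \<alpha>: "\<alpha> = 0 \<or> \<alpha> \<ge> 1" and f: "continuous_on UNIV f" and fB: "\<And>x. \<bar>f x\<bar> \<le> B"
    and z: "z \<in> {0..M}"
  shows "\<bar>fgt_index f z \<alpha>\<bar> \<le> B * M"
proof (cases "z > 0")
  case True
  have B0: "B \<ge> 0" using fB[of 0] by linarith
  have "norm (integral {0..z} (\<lambda>x. fgt_weight \<alpha> z x * f x)) \<le> B * (z - 0)"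
  proof (rule integral_bound)
    show "continuous_on {0..z} (\<lambda>x. fgt_weight \<alpha> z x * f x)"
      by (intro continuous_intros fgt_weight_continuous_on continuous_on_subset[OF f] \<alpha> True) auto
    fix x assume "x \<in> {0..z}"
    then have "fgt_weight \<alpha> z x \<in> {0..1}" by (intro fgt_weight_in_unit_interval \<alpha> True)
    then have "\<bar>fgt_weight \<alpha> z x\<bar> * \<bar>f x\<bar> \<le> 1 * B" using fB[of x] by (intro mult_mono) auto
    then show "norm (fgt_weight \<alpha> z x * f x) \<le> B" by (simp add: abs_mult)
  qed (use True in auto)
  also have "\<dots> \<le> B * M" using z B0 by (intro mult_left_mono) auto
  finally show ?thesis using fgt_index_eq_integral[OF \<alpha> True f] by simp
next
  case False
  have "B \<ge> 0" using fB[of 0] by linarith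
  with False z show ?thesis by (simp add: fgt_index_def)
qed

text \<open>Interchanging the sums exhibits the estimator as a weighted sum over grid points of
  sample averages, the form to which Abel summation applies.\<close>

lemma fgt_estimator_eq:
  assumes "h > 0" "z > 0"
  shows "fgt_estimator K h n x z \<alpha> = (\<Sum>i\<le>nat \<lfloor>z / h\<rfloor>. fgt_weight \<alpha> z (real i * h) *
    ((\<Sum>j = 1..n. bias_reduced_kernel K h ((real i * h - x j) / h)) / real n))"
proof -
  define N where "N = nat \<lfloor>z / h\<rfloor>"
  have "fgt_estimator K h n x z \<alpha> = (\<Sum>j = 1..n. \<Sum>i\<le>N. fgt_weight \<alpha> z (real i * h) *
      bias_reduced_kernel K h ((real i * h - x j) / h)) / real n"
    using assms by (simp add: fgt_estimator_def bias_reduced_kernel_def N_def atMost_atLeast0)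
  also have "\<dots> = (\<Sum>i\<le>N. \<Sum>j = 1..n. fgt_weight \<alpha> z (real i * h) *
      bias_reduced_kernel K h ((real i * h - x j) / h)) / real n"
    by (subst sum.swap) (rule refl)
  finally show ?thesis
    by (simp add: N_def sum_divide_distrib sum_distrib_left)
qed

lemma bdd_above_fgt_estimator:
  assumes \<alpha>: "\<alpha> = 0 \<or> \<alpha> \<ge> 1" and h: "h > 0"
  shows "bdd_above ((\<lambda>z. \<bar>fgt_estimator K h n x z \<alpha>\<bar>) ` {0..M})"
proof (rule bdd_aboveI2)
  fix z assume z: "z \<in> {0..M}"
  let ?a = "\<lambda>i. \<bar>(\<Sum>j = 1..n. bias_reduced_kernel K h ((real i * h - x j) / h)) / real n\<bar>"
  show "\<bar>fgt_estimator K h n x z \<alpha>\<bar> \<le> (\<Sum>i\<le>nat \<lfloor>M / h\<rfloor>. ?a i)"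
  proof (cases "z > 0")
    case True
    have "\<bar>fgt_estimator K h n x z \<alpha>\<bar> \<le> (\<Sum>i\<le>nat \<lfloor>z / h\<rfloor>. ?a i)"
      unfolding fgt_estimator_eq[OF h True]
    proof (rule order_trans[OF sum_abs sum_mono])
      fix i assume "i \<in> {..nat \<lfloor>z / h\<rfloor>}"
      moreover have "0 \<le> z / h" using True h by simp
      ultimately have "real i \<le> z / h" by simp linarith
      then have "real i * h \<le> z" using h by (simp add: field_simps)
      then have "fgt_weight \<alpha> z (real i * h) \<in> {0..1}"
        using h by (intro fgt_weight_in_unit_interval \<alpha> True) auto
      then show "\<bar>fgt_weight \<alpha> z (real i * h) *
          ((\<Sum>j = 1..n. bias_reduced_kernel K h ((real i * h - x j) / h)) / real n)\<bar> \<le> ?a i"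
        unfolding abs_mult by (intro mult_left_le_one_le) auto
    qed
    also have "\<dots> \<le> (\<Sum>i\<le>nat \<lfloor>M / h\<rfloor>. ?a i)"
      using z h by (intro sum_mono2) (auto intro!: nat_mono floor_mono divide_right_mono)
    finally show ?thesis .
  next
    case False
    then show ?thesis by (simp add: fgt_estimator_def sum_nonneg)
  qed
qed

text \<open>The conditionally complete \<open>SUP\<close> on the reals is a genuine least upper
  bound only for sets that are bounded above.\<close>

lemma bdd_above_fgt_error:
  assumes \<alpha>: "\<alpha> = 0 \<or> \<alpha> \<ge> 1" and h: "h > 0"
    and f: "continuous_on UNIV f" and fB: "\<And>x. \<bar>f x\<bar> \<le> B"
  shows "bdd_above ((\<lambda>z. \<bar>fgt_estimator K h n x z \<alpha> - fgt_index f z \<alpha>\<bar>) ` {0..M})"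
proof -
  obtain b where "\<forall>y\<in>(\<lambda>z. \<bar>fgt_estimator K h n x z \<alpha>\<bar>) ` {0..M}. y \<le> b"
    using bdd_above_fgt_estimator[OF \<alpha> h, of K n x M] unfolding bdd_above_def by (rule exE)
  then have b: "\<bar>fgt_estimator K h n x z \<alpha>\<bar> \<le> b" if "z \<in> {0..M}" for z
    using that by (rule bspec[OF _ imageI])
  show ?thesis
  proof (rule bdd_aboveI2)
    fix z assume z: "z \<in> {0..M}"
    show "\<bar>fgt_estimator K h n x z \<alpha> - fgt_index f z \<alpha>\<bar> \<le> b + B * M"
      using b[OF z] abs_fgt_index_le[OF \<alpha> f fB z] by linarith
  qed
qed

lemma borel_measurable_fgt_estimator:
  assumes X: "\<And>j. j \<ge> 1 \<Longrightarrow> X j \<in> borel_measurable \<Omega>"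
    and [measurable]: "K \<in> borel_measurable borel" "deriv (deriv K) \<in> borel_measurable borel"
  shows "(\<lambda>\<omega>. fgt_estimator K h n (\<lambda>j. X j \<omega>) z \<alpha>) \<in> borel_measurable \<Omega>"
proof -
  have [measurable]: "X j \<in> borel_measurable \<Omega>" if "j \<in> {1..n}" for j using X that by simp
  show ?thesis unfolding fgt_estimator_def by measurable
qed

lemma borel_measurable_fgt_sup_error:
  assumes X: "\<And>j. j \<ge> 1 \<Longrightarrow> X j \<in> borel_measurable \<Omega>"
    and K: "K \<in> borel_measurable borel" "deriv (deriv K) \<in> borel_measurable borel"
    and \<alpha>: "\<alpha> = 0 \<or> \<alpha> \<ge> 1" and h: "h > 0" and M: "M > 0"
    and f: "continuous_on UNIV f" and fB: "\<And>x. \<bar>f x\<bar> \<le> B"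
  shows "(\<lambda>\<omega>. SUP z\<in>{0..M}. \<bar>fgt_estimator K h n (\<lambda>j. X j \<omega>) z \<alpha> - fgt_index f z \<alpha>\<bar>)
    \<in> borel_measurable \<Omega>"
proof -
  let ?Q = "{0..M} \<inter> (\<rat> \<union> {0, M})"
  let ?g = "\<lambda>\<omega> z. \<bar>fgt_estimator K h n (\<lambda>j. X j \<omega>) z \<alpha> - fgt_index f z \<alpha>\<bar>"
  have bdd: "bdd_above (?g \<omega> ` {0..M})" for \<omega>
    by (rule bdd_above_fgt_error[OF \<alpha> h f fB])
  have "(SUP z\<in>{0..M}. ?g \<omega> z) = (SUP z\<in>?Q. ?g \<omega> z)" for \<omega>
    using M bdd by (intro cSUP_right_continuous_eq_cSUP_rationals tendsto_intros
        fgt_estimator_tendsto_at_right fgt_index_tendsto_at_right \<alpha> h f) auto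
  moreover have "(\<lambda>\<omega>. SUP z\<in>?Q. ?g \<omega> z) \<in> borel_measurable \<Omega>"
  proof (rule borel_measurable_cSUP)
    show "countable ?Q" by (intro countable_Int2) (auto intro: countable_rat)
    show "(\<lambda>\<omega>. ?g \<omega> z) \<in> borel_measurable \<Omega>" for z
      by (intro borel_measurable_abs borel_measurable_diff borel_measurable_const
            borel_measurable_fgt_estimator X K)
    show "bdd_above (?g \<omega> ` ?Q)" for \<omega>
      by (rule bdd_above_mono[OF bdd]) auto
  qed
  ultimately show ?thesis by simp
qed

subsection \<open>Kernel sums and the bandwidth\<close>

text \<open>Substitution \<open>y = x - h * u\<close>; the Jacobian supplies the factor
  \<open>h\<close>, which becomes the mesh of the Riemann sum.\<close>

lemma (in prob_space) expectation_scaled_shift: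
  fixes f g :: "real \<Rightarrow> real"
  assumes "distributed M lborel X (\<lambda>x. ennreal (f x))" "\<And>x. 0 \<le> f x"
    and [measurable]: "g \<in> borel_measurable borel" and "h > 0"
  shows "expectation (\<lambda>\<omega>. g ((x - X \<omega>) / h)) = h * (LINT u|lborel. g u * f (x - h * u))"
proof -
  have "expectation (\<lambda>\<omega>. g ((x - X \<omega>) / h)) = (LINT y|lborel. f y * g ((x - y) / h))"
    using assms(1,2) by (intro distributed_integral[symmetric]) auto
  also have "\<dots> = h * (LINT u|lborel. f (x - h * u) * g ((x - (x - h * u)) / h))"
    using assms(4) by (subst lborel_integral_real_affine[of "- h" _ x]) auto
  finally show ?thesis using assms(4) by (simp add: mult.commute)
qed

text \<open>Division by \<open>h\<close> turns the grid into the unit-spaced points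
  \<open>real i - x / h\<close>, so the shift bound applies to \<open>K\<close> and to its second
  derivative; \<open>h \<le> 1\<close> bounds the coefficient of the correction.\<close>

lemma sum_bias_reduced_kernel_bounded:
  assumes K: "continuous_on UNIV K" "integrable lborel K" "bounded_variation_on_reals K"
    and K'': "continuous_on UNIV (deriv (deriv K))" "integrable lborel (deriv (deriv K))"
      "bounded_variation_on_reals (deriv (deriv K))"
  obtains C where "\<And>h m x. 0 < h \<Longrightarrow> h \<le> 1 \<Longrightarrow>
    \<bar>\<Sum>i\<le>m. bias_reduced_kernel K h ((real i * h - x) / h)\<bar> \<le> C"
proof -
  define c where "c = (LINT u|lborel. u\<^sup>2 * K u)"
  obtain C1 where C1: "\<And>y m. (\<Sum>i\<le>m. \<bar>K (real i - y)\<bar>) \<le> C1"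
    using bounded_variation_sum_shifts_bounded[OF K] by blast
  obtain C2 where C2: "\<And>y m. (\<Sum>i\<le>m. \<bar>deriv (deriv K) (real i - y)\<bar>) \<le> C2"
    using bounded_variation_sum_shifts_bounded[OF K''] by blast
  have "\<bar>\<Sum>i\<le>m. bias_reduced_kernel K h ((real i * h - x) / h)\<bar> \<le> C1 + \<bar>c\<bar> * C2"
    if h: "0 < h" "h \<le> 1" for h m x
  proof -
    have "h\<^sup>2 \<le> 1" using h by (simp add: power_le_one)
    then have hc: "\<bar>h\<^sup>2 / 2 * c\<bar> \<le> \<bar>c\<bar>"
      unfolding abs_mult by (intro mult_left_le_one_le) auto
    have "\<bar>\<Sum>i\<le>m. bias_reduced_kernel K h ((real i * h - x) / h)\<bar>
        \<le> (\<Sum>i\<le>m. \<bar>K (real i - x / h)\<bar> + \<bar>c\<bar> * \<bar>deriv (deriv K) (real i - x / h)\<bar>)"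
    proof (rule order_trans[OF sum_abs sum_mono])
      fix i
      have eq: "(real i * h - x) / h = real i - x / h" using h by (simp add: field_simps)
      have "\<bar>h\<^sup>2 / 2 * c * deriv (deriv K) (real i - x / h)\<bar> \<le> \<bar>c\<bar> * \<bar>deriv (deriv K) (real i - x / h)\<bar>"
        unfolding abs_mult[of "h\<^sup>2 / 2 * c"] by (intro mult_right_mono hc) auto
      then show "\<bar>bias_reduced_kernel K h ((real i * h - x) / h)\<bar>
          \<le> \<bar>K (real i - x / h)\<bar> + \<bar>c\<bar> * \<bar>deriv (deriv K) (real i - x / h)\<bar>"
        unfolding bias_reduced_kernel_def c_def[symmetric] eq by linarith
    qed
    also have "\<dots> \<le> C1 + \<bar>c\<bar> * C2"
      unfolding sum.distrib sum_distrib_left[symmetric]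
      by (intro add_mono mult_left_mono C1 C2) auto
    finally show ?thesis .
  qed
  then show ?thesis using that by blast
qed

lemma twice_continuously_differentiable_imp_continuous_on:
  assumes "twice_continuously_differentiable g"
  shows "continuous_on UNIV g"
  using assms unfolding twice_continuously_differentiable_def
  by (auto intro!: continuous_at_imp_continuous_on differentiable_imp_continuous_within)

text \<open>Convergence is written with countable quantifiers only. The index is shifted by
  \<open>Suc\<close> because the bandwidth is known to be positive, and hence the error known to be
  measurable, only from 1 on.\<close>

lemma sets_Collect_tendsto_zero:
  fixes S :: "nat \<Rightarrow> 'a \<Rightarrow> real"
  assumes S[measurable]: "\<And>n. n \<ge> 1 \<Longrightarrow> S n \<in> borel_measurable \<Omega>"
  shows "{\<omega> \<in> space \<Omega>. (\<lambda>n. S n \<omega>) \<longlonglongrightarrow> 0} \<in> sets \<Omega>"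
proof -
  have "(\<lambda>n. S n \<omega>) \<longlonglongrightarrow> 0 \<longleftrightarrow> (\<forall>k. \<exists>N. \<forall>n\<ge>N. \<bar>S (Suc n) \<omega>\<bar> < inverse (real (Suc k)))" for \<omega>
  proof -
    have "(\<lambda>n. S n \<omega>) \<longlonglongrightarrow> 0 \<longleftrightarrow> (\<forall>e>0. \<exists>N. \<forall>n\<ge>N. \<bar>S (Suc n) \<omega>\<bar> < e)"
      unfolding filterlim_sequentially_Suc[of "\<lambda>n. S n \<omega>", symmetric] by (simp add: LIMSEQ_iff)
    also have "\<dots> \<longleftrightarrow> (\<forall>k. \<exists>N. \<forall>n\<ge>N. \<bar>S (Suc n) \<omega>\<bar> < inverse (real (Suc k)))"
    proof (intro iffI allI impI)
      fix e :: real
      assume *: "\<forall>k. \<exists>N. \<forall>n\<ge>N. \<bar>S (Suc n) \<omega>\<bar> < inverse (real (Suc k))" and "e > 0"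
      then obtain k where "inverse (real (Suc k)) < e" using reals_Archimedean by blast
      with * show "\<exists>N. \<forall>n\<ge>N. \<bar>S (Suc n) \<omega>\<bar> < e" by (meson order.strict_trans)
    qed simp
    finally show ?thesis .
  qed
  then show ?thesis by simp measurable
qed

text \<open>For large \<open>n\<close>,
  \<open>1 \<le> ln (ln n) \<le> n * (h n)\<^sup>2 \<le> n * h n\<close>, where the last step uses
  \<open>h n < 1\<close>.\<close>

lemma bandwidth_eventually_ge_inverse:
  fixes h :: "nat \<Rightarrow> real"
  assumes h: "h \<longlonglongrightarrow> 0" "\<And>n. n \<ge> 1 \<Longrightarrow> h n > 0"
    and bw: "filterlim (\<lambda>n. real n * (h n)\<^sup>2 / ln (ln (real n))) at_top sequentially"
  shows "\<forall>\<^sub>F n in sequentially. 1 / h n \<le> real n"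
proof -
  have "filterlim (\<lambda>n. ln (ln (real n))) at_top sequentially"
    by (intro filterlim_compose[OF ln_at_top] filterlim_real_sequentially)
  then have "\<forall>\<^sub>F n in sequentially. 1 \<le> ln (ln (real n))"
    unfolding filterlim_at_top by blast
  moreover have "\<forall>\<^sub>F n in sequentially. 1 \<le> real n * (h n)\<^sup>2 / ln (ln (real n))"
    using bw unfolding filterlim_at_top by blast
  moreover have "\<forall>\<^sub>F n in sequentially. h n < 1"
    using order_tendstoD(2)[OF h(1), of 1] by simp
  ultimately show ?thesis
    using eventually_ge_at_top[of 1]
  proof eventually_elim
    case (elim n)
    have hn: "h n > 0" using h(2) elim by simp
    have "1 \<le> ln (ln (real n))" by fact
    also have "\<dots> \<le> real n * (h n)\<^sup>2" using elim by (simp add: le_divide_eq)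
    also have "\<dots> \<le> real n * h n"
      using elim hn by (intro mult_left_mono) (auto simp: power2_eq_square)
    finally show ?case using hn by (simp add: field_simps)
  qed
qed

section \<open>Almost sure uniform convergence of the estimator\<close>

theorem theorem2:
  fixes \<Omega> :: "'a measure"
    and X :: "nat \<Rightarrow> 'a \<Rightarrow> real"
    and f K :: "real \<Rightarrow> real"
    and h :: "nat \<Rightarrow> real"
    and \<alpha> M :: real
  assumes \<alpha>: "\<alpha> = 0 \<or> \<alpha> \<ge> 1"
    and prob: "prob_space \<Omega>"
    and indep: "prob_space.indep_vars \<Omega> (\<lambda>_. borel) X {1..}"
    and density: "\<And>j. j \<ge> 1 \<Longrightarrow> distributed \<Omega> lborel (X j) (\<lambda>x. ennreal (f x))"
    and f_nonneg: "\<And>x. 0 \<le> f x"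
    and f_cont: "continuous_on UNIV f"
    and f_bounded: "bounded (range f)"
    and f_support: "closure {x. f x \<noteq> 0} \<subseteq> {0..}"
    and h_pos: "\<And>n. n \<ge> 1 \<Longrightarrow> h n > 0"
    and h_lim: "h \<longlonglongrightarrow> 0"
    and K_C2: "\<And>G. G \<in> {K, deriv (deriv K)} \<Longrightarrow> twice_continuously_differentiable G"
    and K_integrable: "\<And>G. G \<in> {K, deriv (deriv K)} \<Longrightarrow> integrable lborel G"
    and K_bounded: "\<And>G. G \<in> {K, deriv (deriv K)} \<Longrightarrow> bounded (range G)"
    and K_integral: "(LINT x|lborel. K x) = 1"
    and K_at_top: "\<And>G. G \<in> {K, deriv (deriv K)} \<Longrightarrow> ((\<lambda>x. \<bar>x * G x\<bar>) \<longlongrightarrow> 0) at_top"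
    and K_at_bot: "\<And>G. G \<in> {K, deriv (deriv K)} \<Longrightarrow> ((\<lambda>x. \<bar>x * G x\<bar>) \<longlongrightarrow> 0) at_bot"
    and K_bv: "\<And>G. G \<in> {K, deriv (deriv K)} \<Longrightarrow> bounded_variation_on_reals G"
    and K_moment1: "\<And>G. G \<in> {K, deriv (deriv K)} \<Longrightarrow> integrable lborel (\<lambda>u. u * G u)"
    and K_moment2: "\<And>G. G \<in> {K, deriv (deriv K)} \<Longrightarrow> integrable lborel (\<lambda>u. u\<^sup>2 * G u)"
    and f_diff: "AE x in lborel. twice_differentiable_at f x"
    and f_deriv_L1: "integrable lebesgue (deriv f)"
    and f_deriv2_L1: "integrable lebesgue (deriv (deriv f))"
    and bandwidth: "filterlim (\<lambda>n. real n * (h n)\<^sup>2 / ln (ln (real n))) at_top sequentially"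
    and M: "M > 0"
  shows "measure \<Omega> {\<omega> \<in> space \<Omega>.
           (\<lambda>n. SUP z\<in>{0..M}. \<bar>fgt_estimator K (h n) n (\<lambda>j. X j \<omega>) z \<alpha> - fgt_index f z \<alpha>\<bar>)
             \<longlonglongrightarrow> 0} = 1"
proof -
  interpret prob_space \<Omega> by (rule prob)
  obtain B where fB: "\<And>x. \<bar>f x\<bar> \<le> B"
    using f_bounded unfolding bounded_iff by auto
  have K_cont: "continuous_on UNIV K" "continuous_on UNIV (deriv (deriv K))"
    using K_C2 by (auto intro: twice_continuously_differentiable_imp_continuous_on)
  have K_meas[measurable]: "K \<in> borel_measurable borel" "deriv (deriv K) \<in> borel_measurable borel"
    using K_cont by (auto intro: borel_measurable_continuous_onI)
  have brk_meas[measurable]: "bias_reduced_kernel K t \<in> borel_measurable borel" for t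
    unfolding bias_reduced_kernel_def[abs_def] by measurable
  have X_meas: "X j \<in> borel_measurable \<Omega>" if "j \<ge> 1" for j
    using distributed_measurable[OF density[OF that]] by simp
  have ident: "distr \<Omega> borel (X j) = distr \<Omega> borel (X 1)" if "j \<ge> 1" for j
  proof -
    have "distr \<Omega> borel (X i) = density lborel (\<lambda>x. ennreal (f x))" if "i \<ge> 1" for i
      using distributed_distr_eq_density[OF density[OF that]]
      by (simp cong: distr_cong)
    then show ?thesis using that by simp
  qed
  obtain C where C: "\<And>t m x. 0 < t \<Longrightarrow> t \<le> 1 \<Longrightarrow>
      \<bar>\<Sum>i\<le>m. bias_reduced_kernel K t ((real i * t - x) / t)\<bar> \<le> C"
    using sum_bias_reduced_kernel_bounded[OF K_cont(1) _ _ K_cont(2)] K_integrable K_bv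
    by (metis insertCI)

  \<comment> \<open>The sample average of \<open>\<phi> n m\<close> is the \<open>m\<close>-th
    partial sum of the sample averages at the grid points, the quantity that Abel summation calls
    for; \<open>r n\<close> is the largest grid index that occurs for any
    \<open>z \<le> M\<close>.\<close>
  define \<phi> where "\<phi> = (\<lambda>n m x. \<Sum>i\<le>m. bias_reduced_kernel K (h n) ((real i * h n - x) / h n))"
  define r where "r = (\<lambda>n. nat \<lfloor>M / h n\<rfloor>)"
  define err where "err = (\<lambda>\<omega> n z. \<bar>fgt_estimator K (h n) n (\<lambda>j. X j \<omega>) z \<alpha> - fgt_index f z \<alpha>\<bar>)"
  have [measurable]: "\<phi> n m \<in> borel_measurable borel" for n m
    unfolding \<phi>_def by measurable
  have \<phi>_expectation: "expectation (\<lambda>\<omega>. \<phi> n m (X 1 \<omega>))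
      = (\<Sum>i\<le>m. h n * smoothed_density K f (h n) (real i * h n))" if "n \<ge> 1" for n m
  proof -
    have "integrable \<Omega> (\<lambda>\<omega>. bias_reduced_kernel K (h n) ((real i * h n - X 1 \<omega>) / h n))" for i
    proof -
      obtain b1 b2 where b: "\<And>x. \<bar>K x\<bar> \<le> b1" "\<And>x. \<bar>deriv (deriv K) x\<bar> \<le> b2"
        using K_bounded[of K] K_bounded[of "deriv (deriv K)"] unfolding bounded_iff by auto
      define t where "t = (h n)\<^sup>2 / 2 * (LINT u|lborel. u\<^sup>2 * K u)"
      have "\<bar>bias_reduced_kernel K (h n) x\<bar> \<le> b1 + \<bar>t\<bar> * b2" for x
      proof -
        have "\<bar>t * deriv (deriv K) x\<bar> \<le> \<bar>t\<bar> * b2"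
          unfolding abs_mult by (intro mult_left_mono b) auto
        then show ?thesis
          using b(1)[of x] unfolding bias_reduced_kernel_def t_def[symmetric] by linarith
      qed
      then show ?thesis
        using X_meas[of 1] by (intro integrable_const_bound[of _ "b1 + \<bar>t\<bar> * b2"]) auto
    qed
    then have "expectation (\<lambda>\<omega>. \<phi> n m (X 1 \<omega>))
        = (\<Sum>i\<le>m. expectation (\<lambda>\<omega>. bias_reduced_kernel K (h n) ((real i * h n - X 1 \<omega>) / h n)))"
      unfolding \<phi>_def by (rule Bochner_Integration.integral_sum)
    then show ?thesis
      unfolding smoothed_density_def
      by (simp only: expectation_scaled_shift[OF density[OF order_refl] f_nonneg brk_meas h_pos[OF that]])
  qed
  have h_small: "\<forall>\<^sub>F n in sequentially. h n < 1"
    using order_tendstoD(2)[OF h_lim, of 1] by simp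
  have h_right: "filterlim h (at_right 0) sequentially"
    using h_lim by (rule tendsto_imp_filterlim_at_right)
      (auto intro: eventually_mono[OF eventually_ge_at_top[of 1]] h_pos)
  have bound: "\<forall>\<^sub>F n in sequentially. \<forall>m\<le>r n. \<forall>x. \<bar>\<phi> n m x\<bar> \<le> C"
    using h_small eventually_ge_at_top[of 1]
    by eventually_elim (auto simp: \<phi>_def intro!: C h_pos)
  have "\<forall>\<^sub>F n in sequentially. 1 / h n \<le> real n"
    by (rule bandwidth_eventually_ge_inverse[OF h_lim h_pos bandwidth])
  then have r_le: "\<forall>\<^sub>F n in sequentially. real (r n) \<le> M * real n"
    using eventually_ge_at_top[of 1]
  proof eventually_elim
    case (elim n)
    have "0 \<le> M / h n" using M h_pos[of n] elim by simp
    then have "real (r n) \<le> M * (1 / h n)" unfolding r_def by simp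
    also have "\<dots> \<le> M * real n" using elim M by (intro mult_left_mono) auto
    finally show ?case .
  qed

  \<comment> \<open>Countably many thresholds \<open>inverse (real (Suc k))\<close> allow a single
    null set to serve every \<open>e > 0\<close>.\<close>
  have "AE \<omega> in \<Omega>. \<forall>k. \<forall>\<^sub>F n in sequentially. \<forall>m\<le>r n.
      \<bar>(\<Sum>j = 1..n. \<phi> n m (X j \<omega>)) / real n - expectation (\<lambda>\<omega>. \<phi> n m (X 1 \<omega>))\<bar> < inverse (real (Suc k))"
    unfolding AE_all_countable
    by (intro allI AE_eventually_uniform_deviation_less[OF indep ident _ bound r_le]) auto
  then have AE_lim: "AE \<omega> in \<Omega>. (\<lambda>n. SUP z\<in>{0..M}. err \<omega> n z) \<longlonglongrightarrow> 0"
  proof (rule AE_mp, intro AE_I2 impI)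
    fix \<omega>
    assume dev: "\<forall>k. \<forall>\<^sub>F n in sequentially. \<forall>m\<le>r n.
      \<bar>(\<Sum>j = 1..n. \<phi> n m (X j \<omega>)) / real n - expectation (\<lambda>\<omega>. \<phi> n m (X 1 \<omega>))\<bar> < inverse (real (Suc k))"
    show "(\<lambda>n. SUP z\<in>{0..M}. err \<omega> n z) \<longlonglongrightarrow> 0"
    proof (rule tendstoI)
      fix e :: real assume e: "e > 0"
      \<comment> \<open>Fluctuation and bias get \<open>e / 4\<close> each; the resulting bound
        \<open>e / 2\<close> on every error keeps the supremum strictly below
        \<open>e\<close>.\<close>
      obtain k where k: "inverse (real (Suc k)) < e / 4"
        using reals_Archimedean[of "e / 4"] e by auto
      have "\<forall>\<^sub>F t in at_right 0. \<forall>z\<in>{0<..M}. \<bar>(\<Sum>i\<le>nat \<lfloor>z / t\<rfloor>. fgt_weight \<alpha> z (real i * t) *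
          (t * smoothed_density K f t (real i * t))) - fgt_index f z \<alpha>\<bar> \<le> e / 4"
        using K_integrable K_moment1 K_integral e
        by (intro fgt_bias_uniform_limit[OF \<alpha> M f_cont fB]) auto
      then have "\<forall>\<^sub>F n in sequentially. \<forall>z\<in>{0<..M}. \<bar>(\<Sum>i\<le>nat \<lfloor>z / h n\<rfloor>. fgt_weight \<alpha> z (real i * h n) *
          (h n * smoothed_density K f (h n) (real i * h n))) - fgt_index f z \<alpha>\<bar> \<le> e / 4"
        using h_right by (rule eventually_compose_filterlim)
      with dev[rule_format, of k] eventually_ge_at_top[of 1]
      show "\<forall>\<^sub>F n in sequentially. dist (SUP z\<in>{0..M}. err \<omega> n z) 0 < e"
      proof eventually_elim
        case (elim n)
        have hn: "h n > 0" using elim h_pos by simp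
        have err_le: "err \<omega> n z \<le> e / 2" if z: "z \<in> {0..M}" for z
        proof (cases "z > 0")
          case False
          then show ?thesis using e by (simp add: err_def fgt_estimator_def fgt_index_def)
        next
          case True
          define N where "N = nat \<lfloor>z / h n\<rfloor>"
          have "0 \<le> z / h n" using True hn by simp
          then have "real N \<le> z / h n" unfolding N_def by simp
          then have Nh: "real N * h n \<le> z" using hn by (simp add: field_simps)
          \<comment> \<open>Thus the deviation bound for all \<open>m \<le> r n\<close> covers the
            partial sums needed for every \<open>z\<close> at once.\<close>
          have Nr: "N \<le> r n"
            unfolding N_def r_def using z hn by (intro nat_mono floor_mono divide_right_mono) auto
          define a where "a = (\<lambda>i. (\<Sum>j = 1..n. bias_reduced_kernel K (h n) ((real i * h n - X j \<omega>) / h n)) / real n)"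
          define \<mu> where "\<mu> = (\<lambda>i. h n * smoothed_density K f (h n) (real i * h n))"
          let ?w = "\<lambda>i. fgt_weight \<alpha> z (real i * h n)"
          \<comment> \<open>The terms \<open>a i - \<mu> i\<close> are not bounded one by one: their
            number grows like \<open>1 / h n\<close>, while the partial sums stay below
            \<open>e / 4\<close>.\<close>
          have "\<bar>\<Sum>i\<le>N. ?w i * (a i - \<mu> i)\<bar> \<le> ?w 0 * (e / 4)"
          proof (rule abs_sum_antimono_weights_le)
            fix m assume m: "m \<le> N"
            have "(\<Sum>j = 1..n. \<phi> n m (X j \<omega>)) / real n = (\<Sum>i\<le>m. a i)"
              unfolding \<phi>_def a_def by (subst sum.swap) (simp add: sum_divide_distrib)
            moreover have "expectation (\<lambda>\<omega>. \<phi> n m (X 1 \<omega>)) = (\<Sum>i\<le>m. \<mu> i)"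
              unfolding \<mu>_def using elim by (intro \<phi>_expectation) simp
            moreover have "\<bar>(\<Sum>j = 1..n. \<phi> n m (X j \<omega>)) / real n - expectation (\<lambda>\<omega>. \<phi> n m (X 1 \<omega>))\<bar>
                < inverse (real (Suc k))"
              using elim(1) m Nr le_trans by blast
            ultimately show "\<bar>\<Sum>i\<le>m. a i - \<mu> i\<bar> \<le> e / 4"
              using k unfolding sum_subtractf by linarith
          next
            fix i assume "i < N"
            then have "real (Suc i) * h n \<le> real N * h n" using hn by (intro mult_right_mono) auto
            then have "real (Suc i) * h n \<le> z" using Nh by (rule order_trans)
            moreover have "0 \<le> real i * h n" "real i * h n \<le> real (Suc i) * h n" using hn by (auto simp: distrib_right)
            ultimately show "?w (Suc i) \<le> ?w i"
              using fgt_weight_antimono_on[OF \<alpha> True] unfolding monotone_on_def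
              by (meson atLeastAtMost_iff order_trans)
          next
            show "0 \<le> ?w N"
              using fgt_weight_in_unit_interval[OF \<alpha> True, of "real N * h n"] Nh hn by simp
          qed
          also have "\<dots> \<le> 1 * (e / 4)"
            using fgt_weight_in_unit_interval[OF \<alpha> True, of 0] True e by (intro mult_right_mono) auto
          finally have "\<bar>(\<Sum>i\<le>N. ?w i * a i) - (\<Sum>i\<le>N. ?w i * \<mu> i)\<bar> \<le> e / 4"
            by (simp add: right_diff_distrib sum_subtractf)
          moreover have "\<bar>(\<Sum>i\<le>N. ?w i * \<mu> i) - fgt_index f z \<alpha>\<bar> \<le> e / 4"
            using elim(3) z True unfolding N_def \<mu>_def by simp
          moreover have "fgt_estimator K (h n) n (\<lambda>j. X j \<omega>) z \<alpha> = (\<Sum>i\<le>N. ?w i * a i)"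
            unfolding N_def a_def by (rule fgt_estimator_eq[OF hn True])
          ultimately show ?thesis unfolding err_def by linarith
        qed
        have "(SUP z\<in>{0..M}. err \<omega> n z) \<le> e / 2"
          using M by (intro cSUP_least err_le) auto
        \<comment> \<open>The value at \<open>z = 0\<close> serves as a witness that the supremum is
          nonnegative.\<close>
        moreover have "0 \<le> err \<omega> n 0" by (simp add: err_def)
        then have "0 \<le> (SUP z\<in>{0..M}. err \<omega> n z)"
          by (rule cSUP_upper2[rotated 2])
             (use M err_le in \<open>auto intro!: bdd_aboveI2[of _ _ "e / 2"]\<close>)
        ultimately show ?case using e by (simp add: dist_real_def)
      qed
    qed
  qed
  \<comment> \<open>\<open>measure\<close> takes the default value 0 on nonmeasurable sets, so the
    almost sure statement yields probability 1 only once the event is known to be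
    measurable.\<close>
  have "{\<omega> \<in> space \<Omega>. (\<lambda>n. SUP z\<in>{0..M}. err \<omega> n z) \<longlonglongrightarrow> 0} \<in> events"
    unfolding err_def
    by (intro sets_Collect_tendsto_zero borel_measurable_fgt_sup_error[where B = B] X_meas K_meas \<alpha> h_pos M f_cont fB)
  then show ?thesis
    using AE_lim prob_Collect_eq_1 unfolding err_def by simp
qed

end
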